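(* (a) For every set $X$ and every $R\subseteq X\times X$, the following inclusions and equalities hold between relations on $\beta X$: $$R\subseteq -((-R)^* ),\qquad -((-R)^* )\subseteq\widetilde R=-(\widetilde{-R}),\qquad -((-R)^* )\subseteq(\widetilde{R^{-1}})^{-1},$$ $$\widetilde R\subseteq R^*,\qquad (\widetilde{R^{-1}})^{-1}\subseteq R^*=((R^{-1})^* )^{-1}.$$ (b) In general, these inclusions are non-reversible: for each of the five inclusions $R\subseteq -((-R)^* )$, $-((-R)^* )\subseteq\widetilde R$, $-((-R)^* )\subseteq(\widetilde{R^{-1}})^{-1}$, $\widetilde R\subseteq R^*$, $(\widetilde{R^{-1}})^{-1}\subseteq R^*$ there are a set $X$ and $R\subseteq X\times X$ for which the inclusion is strict. (c) Moreover, each of all possible relationships between the four extensions is satisfied in some model: for every choice of which inclusions hold and which fail among four sets $A,B,C,D$ that is realized by some sets with $A\subseteq B\subseteq D$ and $A\subseteq C\subseteq D$, there are a set $X$ and $R\subseteq X\times X$ such that exactly the same inclusions hold and fail among $A=-((-R)^* )$, $B=\widetilde R$, $C=(\widetilde{R^{-1}})^{-1}$, $D=R^*$.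
   Context: $\beta X$ denotes the set of ultrafilters over the set $X$; $X$ is identified with the subset of $\beta X$ consisting of principal ultrafilters, so a relation $R\subseteq X\times X$ is also regarded as a subset of $\beta X\times\beta X$. For $R\subseteq X\times X$ the relations $\widetilde R,R^*\subseteq\beta X\times\beta X$ are defined, for $u,v\in\beta X$, by $$\widetilde R(u,v)\iff\{x:\{y:R(x,y)\}\in v\}\in u,$$ $$R^*(u,v)\iff(\forall S\in v)\ \{x:(\exists y\in S)\,R(x,y)\}\in u.$$ The sign $-$ denotes complement: $-R=(X\times X)\setminus R$ for $R\subseteq X\times X$, and $-Q=(\beta X\times\beta X)\setminus Q$ for a relation $Q$ on $\beta X$ (so $-((-R)^* )=(\beta X\times\beta X)\setminus((X\times X)\setminus R)^*$). For a relation $Q$, $Q^{-1}=\{(b,a):(a,b)\in Q\}$. *)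

theory Defs
  imports Main
begin

text \<open>
  Ultrafilters over a carrier set \<open>X\<close> are represented as families of subsets of \<open>X\<close>.
  The degenerate carrier \<open>X = {}\<close> has no ultrafilter.
\<close>

definition ultrafilter_over :: "'a set \<Rightarrow> 'a set set \<Rightarrow> bool" where
  "ultrafilter_over X u \<longleftrightarrow>
     u \<subseteq> Pow X \<and> X \<in> u \<and> {} \<notin> u \<and>
     (\<forall>S\<in>u. \<forall>T\<in>u. S \<inter> T \<in> u) \<and>
     (\<forall>S\<in>u. \<forall>T. S \<subseteq> T \<and> T \<subseteq> X \<longrightarrow> T \<in> u) \<and>
     (\<forall>S. S \<subseteq> X \<longrightarrow> S \<in> u \<or> X - S \<in> u)"

definition beta :: "'a set \<Rightarrow> 'a set set set" where
  "beta X = {u. ultrafilter_over X u}"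

definition principal_uf :: "'a set \<Rightarrow> 'a \<Rightarrow> 'a set set" where
  "principal_uf X x = {S. S \<subseteq> X \<and> x \<in> S}"

text \<open>A relation on \<open>X\<close>, regarded as a relation on \<open>beta X\<close> between principal ultrafilters.\<close>

definition beta_embed :: "'a set \<Rightarrow> 'a rel \<Rightarrow> 'a set set rel" where
  "beta_embed X R = {(principal_uf X x, principal_uf X y) | x y. (x, y) \<in> R}"

definition rel_compl :: "'a set \<Rightarrow> 'a rel \<Rightarrow> 'a rel" where
  "rel_compl Y Q = (Y \<times> Y) - Q"

definition tilde_ext :: "'a set \<Rightarrow> 'a rel \<Rightarrow> 'a set set rel" where
  "tilde_ext X R =
     {(u, v). u \<in> beta X \<and> v \<in> beta X \<and> {x\<in>X. {y\<in>X. (x, y) \<in> R} \<in> v} \<in> u}"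

definition star_ext :: "'a set \<Rightarrow> 'a rel \<Rightarrow> 'a set set rel" where
  "star_ext X R =
     {(u, v). u \<in> beta X \<and> v \<in> beta X \<and> (\<forall>S\<in>v. {x\<in>X. \<exists>y\<in>S. (x, y) \<in> R} \<in> u)}"

text \<open>The dual \<open>-((-R)\<^sup>*)\<close>: the inner complement is in \<open>X \<times> X\<close>, the outer one in \<open>beta X \<times> beta X\<close>.\<close>

definition costar_ext :: "'a set \<Rightarrow> 'a rel \<Rightarrow> 'a set set rel" where
  "costar_ext X R = rel_compl (beta X) (star_ext X (rel_compl X R))"

definition tilde_conv_ext :: "'a set \<Rightarrow> 'a rel \<Rightarrow> 'a set set rel" where
  "tilde_conv_ext X R = (tilde_ext X (R\<inverse>))\<inverse>"

text \<open>The same inclusions hold, and the same fail, among the members of two lists of sets.\<close>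

definition same_inclusions :: "'a set list \<Rightarrow> 'b set list \<Rightarrow> bool" where
  "same_inclusions As Bs \<longleftrightarrow>
     length As = length Bs \<and>
     (\<forall>i<length As. \<forall>j<length As. As ! i \<subseteq> As ! j \<longleftrightarrow> Bs ! i \<subseteq> Bs ! j)"

end

theory Submission
  imports Defs
begin

text \<open>
  For ultrafilters \<open>u\<close>, \<open>v\<close> over \<open>X\<close>, call \<open>T \<times> S\<close> with \<open>T \<in> u\<close> and \<open>S \<in> v\<close> a box. Then
  \<open>-((-R)\<^sup>*)\<close> holds at \<open>(u, v)\<close> iff \<open>R\<close> contains a box, and \<open>R\<^sup>*\<close> holds iff \<open>R\<close> meets
  every box (\<open>costar_ext_iff\<close>, \<open>star_ext_iff\<close>). Both conditions are symmetric in the two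
  coordinates, whereas the two tilde extensions are iterated quantifiers ``for \<open>u\<close>-almost all \<open>x\<close>,
  for \<open>v\<close>-almost all \<open>y\<close>'' in the two possible orders. All the inclusions follow at once.

  Given \<open>A \<subseteq> B \<subseteq> D\<close> and \<open>A \<subseteq> C \<subseteq> D\<close>, the inclusions among the four sets depend only on which
  of the regions \<open>(B \<inter> C) - A\<close>, \<open>B - C\<close>, \<open>C - B\<close>, \<open>D - (B \<union> C)\<close> are empty
  (\<open>same_inclusionsI\<close>). The four extensions agree at \<open>(u, v)\<close> as soon as \<open>u\<close> or \<open>v\<close> is principal
  (\<open>star_ext_imp_costar_ext_if_principal\<close>), so only pairs of nonprincipal ultrafilters over the
  natural numbers matter. On such pairs each of the relations \<open>\<noteq>\<close>, \<open><\<close>, \<open>>\<close>, \<open>=\<close> makes exactly one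
  region nonempty: for \<open>\<noteq>\<close>, both tilde extensions always hold but no box lies in \<open>\<noteq>\<close> when
  \<open>u = v\<close>; for \<open><\<close> and \<open>>\<close>, one order of quantification gives truth and the other falsity; for
  \<open>=\<close>, both tilde extensions fail but every box meets the diagonal when \<open>u = v\<close>. A disjoint union
  of any selection of these relations, one on each residue class modulo 4 (\<open>model_rel\<close>), therefore
  realizes any prescribed set of nonempty regions. The strict inclusions between the extensions are
  special cases; the first one is strict for the full relation, because nonprincipal ultrafilters
  exist.
\<close>

section \<open>Ultrafilters\<close>

lemma ultrafilter_over_Int:
  "ultrafilter_over X u \<Longrightarrow> S \<in> u \<Longrightarrow> T \<in> u \<Longrightarrow> S \<inter> T \<in> u"
  by (simp add: ultrafilter_over_def)

lemma ultrafilter_over_mono: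
  "ultrafilter_over X u \<Longrightarrow> S \<in> u \<Longrightarrow> S \<subseteq> T \<Longrightarrow> T \<subseteq> X \<Longrightarrow> T \<in> u"
  by (simp add: ultrafilter_over_def)

lemma ultrafilter_over_subset: "ultrafilter_over X u \<Longrightarrow> S \<in> u \<Longrightarrow> S \<subseteq> X"
  by (auto simp add: ultrafilter_over_def)

lemma ultrafilter_over_nonempty: "ultrafilter_over X u \<Longrightarrow> S \<in> u \<Longrightarrow> S \<noteq> {}"
  by (auto simp add: ultrafilter_over_def)

lemma ultrafilter_over_Diff_iff:
  assumes "ultrafilter_over X u" "S \<subseteq> X"
  shows "X - S \<in> u \<longleftrightarrow> S \<notin> u"
proof -
  have "\<not> (S \<in> u \<and> X - S \<in> u)"
    using ultrafilter_over_Int[OF assms(1), of S "X - S"]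
      ultrafilter_over_nonempty[OF assms(1)] by auto
  moreover have "S \<in> u \<or> X - S \<in> u"
    using assms by (simp add: ultrafilter_over_def)
  ultimately show ?thesis by blast
qed

lemma ultrafilter_over_mem_iff_meets:
  assumes "ultrafilter_over X u" "Z \<subseteq> X"
  shows "Z \<in> u \<longleftrightarrow> (\<forall>T\<in>u. Z \<inter> T \<noteq> {})"
proof
  assume "Z \<in> u"
  then show "\<forall>T\<in>u. Z \<inter> T \<noteq> {}"
    using ultrafilter_over_Int[OF assms(1)] ultrafilter_over_nonempty[OF assms(1)] by blast
next
  assume "\<forall>T\<in>u. Z \<inter> T \<noteq> {}"
  then have "X - Z \<notin> u" by blast
  then show "Z \<in> u" using ultrafilter_over_Diff_iff[OF assms] by blast
qed

lemma ultrafilter_over_principal_uf: "x \<in> X \<Longrightarrow> ultrafilter_over X (principal_uf X x)"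
  by (auto simp add: ultrafilter_over_def principal_uf_def)

lemma nonprincipal_finite_notin:
  assumes u: "ultrafilter_over X u" and np: "\<And>x. {x} \<notin> u" and "finite S"
  shows "S \<notin> u"
  using \<open>finite S\<close>
proof (induction S)
  case empty
  then show ?case using ultrafilter_over_nonempty[OF u] by blast
next
  case (insert x F)
  show ?case
  proof
    assume in_u: "insert x F \<in> u"
    then have sub: "insert x F \<subseteq> X" by (rule ultrafilter_over_subset[OF u])
    then have "X - {x} \<in> u" using ultrafilter_over_Diff_iff[OF u, of "{x}"] np by auto
    then have "insert x F \<inter> (X - {x}) \<in> u" by (rule ultrafilter_over_Int[OF u in_u])
    then have "F \<in> u" by (rule ultrafilter_over_mono[OF u]) (use sub in auto)
    with insert.IH show False ..
  qed
qed

text \<open>A proper filter over \<open>X\<close>: all the conditions on an ultrafilter except the dichotomy.\<close>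

definition proper_filter_over :: "'a set \<Rightarrow> 'a set set \<Rightarrow> bool" where
  "proper_filter_over X F \<longleftrightarrow>
     F \<subseteq> Pow X \<and> X \<in> F \<and> {} \<notin> F \<and>
     (\<forall>S\<in>F. \<forall>T\<in>F. S \<inter> T \<in> F) \<and>
     (\<forall>S\<in>F. \<forall>T. S \<subseteq> T \<and> T \<subseteq> X \<longrightarrow> T \<in> F)"

lemma proper_filter_over_Union_chain:
  assumes "subset.chain {F. proper_filter_over X F} \<C>" "\<C> \<noteq> {}"
  shows "proper_filter_over X (\<Union>\<C>)"
proof -
  have pf: "proper_filter_over X F" if "F \<in> \<C>" for F
    using assms(1) that by (auto simp add: subset.chain_def)
  show ?thesis
    unfolding proper_filter_over_def
  proof (intro conjI ballI allI impI)
    show "\<Union>\<C> \<subseteq> Pow X" "{} \<notin> \<Union>\<C>"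
      using pf unfolding proper_filter_over_def by blast+
    show "X \<in> \<Union>\<C>" using pf assms(2) by (auto simp add: proper_filter_over_def)
  next
    fix S T assume "S \<in> \<Union>\<C>" "T \<in> \<Union>\<C>"
    then obtain F G where FG: "F \<in> \<C>" "S \<in> F" "G \<in> \<C>" "T \<in> G" by blast
    then have "F \<subseteq> G \<or> G \<subseteq> F" using assms(1) by (auto simp add: subset_chain_def)
    then show "S \<inter> T \<in> \<Union>\<C>"
    proof
      assume "F \<subseteq> G"
      then have "S \<inter> T \<in> G" using FG pf[of G] by (auto simp add: proper_filter_over_def)
      then show ?thesis using FG by blast
    next
      assume "G \<subseteq> F"
      then have "S \<inter> T \<in> F" using FG pf[of F] by (auto simp add: proper_filter_over_def)
      then show ?thesis using FG by blast
    qed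
  next
    fix S T assume "S \<in> \<Union>\<C>" and T: "S \<subseteq> T \<and> T \<subseteq> X"
    then obtain F where F: "F \<in> \<C>" "S \<in> F" by blast
    then have "T \<in> F" using pf[of F] T by (simp add: proper_filter_over_def)
    then show "T \<in> \<Union>\<C>" using F by blast
  qed
qed

lemma proper_filter_over_extends_to_ultrafilter_over:
  assumes F: "proper_filter_over X F"
  shows "\<exists>u. ultrafilter_over X u \<and> F \<subseteq> u"
proof -
  have "\<exists>M\<in>{G. proper_filter_over X G \<and> F \<subseteq> G}.
          \<forall>G\<in>{G. proper_filter_over X G \<and> F \<subseteq> G}. M \<subseteq> G \<longrightarrow> G = M"
  proof (rule subset_Zorn_nonempty)
    show "{G. proper_filter_over X G \<and> F \<subseteq> G} \<noteq> {}" using F by blast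
  next
    fix \<C> :: "'a set set set"
    assume \<C>: "\<C> \<noteq> {}" "subset.chain {G. proper_filter_over X G \<and> F \<subseteq> G} \<C>"
    then have "subset.chain {G. proper_filter_over X G} \<C>"
      by (auto simp add: subset_chain_def)
    then have "proper_filter_over X (\<Union>\<C>)"
      using \<C>(1) by (rule proper_filter_over_Union_chain)
    moreover have "F \<subseteq> \<Union>\<C>"
      using \<C> unfolding subset_chain_def by blast
    ultimately show "\<Union>\<C> \<in> {G. proper_filter_over X G \<and> F \<subseteq> G}" by blast
  qed
  then obtain M where "M \<in> {G. proper_filter_over X G \<and> F \<subseteq> G}"
    and max': "\<forall>G\<in>{G. proper_filter_over X G \<and> F \<subseteq> G}. M \<subseteq> G \<longrightarrow> G = M" ..
  then have M: "proper_filter_over X M" "F \<subseteq> M" by simp_all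
  have max: "G = M" if "proper_filter_over X G" "M \<subseteq> G" for G
    using max' M(2) that by simp
  have "X - S \<in> M" if S: "S \<subseteq> X" "S \<notin> M" for S
  proof -
    \<comment> \<open>the filter generated by \<open>M\<close> and \<open>S\<close>, which must be improper\<close>
    define G where "G = {T. T \<subseteq> X \<and> (\<exists>N\<in>M. N \<inter> S \<subseteq> T)}"
    have "M \<subseteq> G" using M(1) by (auto simp add: G_def proper_filter_over_def)
    have "S \<in> G" using M(1) S by (auto simp add: G_def proper_filter_over_def)
    have "P \<inter> Q \<in> G" if PQ: "P \<in> G" "Q \<in> G" for P Q
    proof -
      from PQ obtain N N' where N: "N \<in> M" "N \<inter> S \<subseteq> P" "N' \<in> M" "N' \<inter> S \<subseteq> Q"
        by (auto simp add: G_def)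
      then have "N \<inter> N' \<in> M" using M(1) by (simp add: proper_filter_over_def)
      moreover have "(N \<inter> N') \<inter> S \<subseteq> P \<inter> Q" "P \<inter> Q \<subseteq> X" using N PQ by (auto simp add: G_def)
      ultimately show ?thesis unfolding G_def by blast
    qed
    moreover have "X \<in> G" using \<open>M \<subseteq> G\<close> M(1) by (auto simp add: proper_filter_over_def)
    moreover have "G \<subseteq> Pow X" by (auto simp add: G_def)
    moreover have "T \<in> G" if "P \<in> G" "P \<subseteq> T" "T \<subseteq> X" for P T
      using that unfolding G_def by blast
    moreover have "G \<noteq> M" using \<open>S \<in> G\<close> S by blast
    then have "\<not> proper_filter_over X G" using max \<open>M \<subseteq> G\<close> by blast
    ultimately have "{} \<in> G" unfolding proper_filter_over_def by meson
    then obtain N where "N \<in> M" "N \<inter> S = {}" by (auto simp add: G_def)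
    moreover from this have "N \<subseteq> X - S" using M(1) by (auto simp add: proper_filter_over_def)
    ultimately show ?thesis using M(1) by (auto simp add: proper_filter_over_def)
  qed
  then have "ultrafilter_over X M"
    using M(1) unfolding ultrafilter_over_def proper_filter_over_def by meson
  then show ?thesis using M(2) by blast
qed

lemma ex_nonprincipal_ultrafilter_over:
  assumes "infinite K" "K \<subseteq> X"
  shows "\<exists>u. ultrafilter_over X u \<and> K \<in> u \<and> (\<forall>x. {x} \<notin> u)"
proof -
  \<comment> \<open>the sets that contain all but finitely many elements of \<open>K\<close>\<close>
  define F where "F = {T. T \<subseteq> X \<and> finite (K - T)}"
  have "proper_filter_over X F"
    unfolding proper_filter_over_def
  proof (intro conjI ballI allI impI)
    show "F \<subseteq> Pow X" by (auto simp add: F_def)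
    show "X \<in> F" using assms by (auto simp add: F_def Diff_eq_empty_iff[THEN iffD2])
    show "{} \<notin> F" using assms by (simp add: F_def)
  next
    fix S T assume "S \<in> F" "T \<in> F"
    then show "S \<inter> T \<in> F" by (auto simp add: F_def Diff_Int)
  next
    fix S T assume "S \<in> F" "S \<subseteq> T \<and> T \<subseteq> X"
    then show "T \<in> F" unfolding F_def by (auto intro: finite_subset[of "K - T" "K - S"])
  qed
  then obtain u where u: "ultrafilter_over X u" "F \<subseteq> u"
    using proper_filter_over_extends_to_ultrafilter_over by blast
  have "K \<in> u" using u(2) assms by (auto simp add: F_def)
  moreover have "{x} \<notin> u" for x
  proof
    assume x: "{x} \<in> u"
    have "K - (X - {x}) \<subseteq> {x}" using assms by blast
    then have "finite (K - (X - {x}))" by (rule finite_subset) simp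
    then have "X - {x} \<in> u" using u(2) by (auto simp add: F_def)
    then have "{x} \<inter> (X - {x}) \<in> u" by (rule ultrafilter_over_Int[OF u(1) x])
    then show False using ultrafilter_over_nonempty[OF u(1)] by blast
  qed
  ultimately show ?thesis using u(1) by blast
qed

section \<open>Boxes and the inclusions between the extensions\<close>

text \<open>\<open>R\<^sup>*\<close> holds at a pair iff \<open>R\<close> meets every box, a condition symmetric in the two coordinates.\<close>

lemma star_ext_iff:
  "(u, v) \<in> star_ext X R \<longleftrightarrow>
     u \<in> beta X \<and> v \<in> beta X \<and> (\<forall>S\<in>v. \<forall>T\<in>u. R \<inter> (T \<times> S) \<noteq> {})"
proof -
  have "{x\<in>X. \<exists>y\<in>S. (x, y) \<in> R} \<in> u \<longleftrightarrow> (\<forall>T\<in>u. R \<inter> (T \<times> S) \<noteq> {})"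
    if u: "ultrafilter_over X u" for S
  proof -
    have "{x\<in>X. \<exists>y\<in>S. (x, y) \<in> R} \<in> u \<longleftrightarrow>
            (\<forall>T\<in>u. {x\<in>X. \<exists>y\<in>S. (x, y) \<in> R} \<inter> T \<noteq> {})"
      by (rule ultrafilter_over_mem_iff_meets[OF u]) blast
    also have "\<dots> \<longleftrightarrow> (\<forall>T\<in>u. R \<inter> (T \<times> S) \<noteq> {})"
    proof (rule ball_cong[OF refl])
      fix T assume "T \<in> u"
      then have "T \<subseteq> X" by (rule ultrafilter_over_subset[OF u])
      then show "{x\<in>X. \<exists>y\<in>S. (x, y) \<in> R} \<inter> T \<noteq> {} \<longleftrightarrow> R \<inter> (T \<times> S) \<noteq> {}" by blast
    qed
    finally show ?thesis .
  qed
  then show ?thesis by (auto simp add: star_ext_def beta_def)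
qed

text \<open>Dually, \<open>-((-R)\<^sup>*)\<close> holds at a pair iff \<open>R\<close> contains a box.\<close>

lemma costar_ext_iff:
  "(u, v) \<in> costar_ext X R \<longleftrightarrow>
     u \<in> beta X \<and> v \<in> beta X \<and> (\<exists>S\<in>v. \<exists>T\<in>u. T \<times> S \<subseteq> R)"
proof (cases "u \<in> beta X \<and> v \<in> beta X")
  case True
  have "rel_compl X R \<inter> (T \<times> S) = {} \<longleftrightarrow> T \<times> S \<subseteq> R" if "T \<in> u" "S \<in> v" for S T
  proof -
    have "T \<times> S \<subseteq> X \<times> X"
      using that True ultrafilter_over_subset[of X] unfolding beta_def by blast
    then show ?thesis unfolding rel_compl_def by blast
  qed
  moreover have "(u, v) \<in> costar_ext X R \<longleftrightarrow> \<not> (u, v) \<in> star_ext X (rel_compl X R)"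
    using True by (simp add: costar_ext_def rel_compl_def[of "beta X"])
  ultimately show ?thesis using True by (simp add: star_ext_iff)
qed (auto simp add: costar_ext_def rel_compl_def[of "beta X"])

lemma tilde_conv_ext_iff:
  "(u, v) \<in> tilde_conv_ext X R \<longleftrightarrow>
     u \<in> beta X \<and> v \<in> beta X \<and> {y\<in>X. {x\<in>X. (x, y) \<in> R} \<in> u} \<in> v"
  by (auto simp add: tilde_conv_ext_def tilde_ext_def)

lemma star_ext_converse: "star_ext X (R\<inverse>) = (star_ext X R)\<inverse>"
proof (rule set_eqI)
  fix p :: "'a set set \<times> 'a set set"
  obtain u v where p: "p = (u, v)" by (cases p)
  have "R\<inverse> \<inter> (T \<times> S) \<noteq> {} \<longleftrightarrow> R \<inter> (S \<times> T) \<noteq> {}" for S T by blast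
  then show "p \<in> star_ext X (R\<inverse>) \<longleftrightarrow> p \<in> (star_ext X R)\<inverse>"
    by (auto simp add: p star_ext_iff)
qed

lemma costar_ext_converse: "costar_ext X (R\<inverse>) = (costar_ext X R)\<inverse>"
proof (rule set_eqI)
  fix p :: "'a set set \<times> 'a set set"
  obtain u v where p: "p = (u, v)" by (cases p)
  have "T \<times> S \<subseteq> R\<inverse> \<longleftrightarrow> S \<times> T \<subseteq> R" for S T by blast
  then show "p \<in> costar_ext X (R\<inverse>) \<longleftrightarrow> p \<in> (costar_ext X R)\<inverse>"
    by (auto simp add: p costar_ext_iff)
qed

lemma beta_embed_subset_costar_ext:
  assumes "R \<subseteq> X \<times> X"
  shows "beta_embed X R \<subseteq> costar_ext X R"
proof
  fix p assume "p \<in> beta_embed X R"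
  then obtain x y where p: "p = (principal_uf X x, principal_uf X y)" and xy: "(x, y) \<in> R"
    by (auto simp add: beta_embed_def)
  then have "x \<in> X" "y \<in> X" using assms by auto
  then have "principal_uf X x \<in> beta X" "principal_uf X y \<in> beta X"
    "{y} \<in> principal_uf X y" "{x} \<in> principal_uf X x"
    by (simp_all add: beta_def ultrafilter_over_principal_uf) (simp_all add: principal_uf_def)
  moreover have "{x} \<times> {y} \<subseteq> R" using xy by simp
  ultimately show "p \<in> costar_ext X R" unfolding p costar_ext_iff by blast
qed

lemma costar_ext_subset_tilde_ext: "costar_ext X R \<subseteq> tilde_ext X R"
proof (rule subrelI)
  fix u v assume "(u, v) \<in> costar_ext X R"
  then obtain S T where u: "ultrafilter_over X u" and v: "ultrafilter_over X v"
    and ST: "S \<in> v" "T \<in> u" "T \<times> S \<subseteq> R"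
    by (auto simp add: costar_ext_iff beta_def)
  have "{y\<in>X. (x, y) \<in> R} \<in> v" if "x \<in> T" for x
    using ST that ultrafilter_over_subset[OF v]
    by (intro ultrafilter_over_mono[OF v ST(1)]) auto
  then have "{x\<in>X. {y\<in>X. (x, y) \<in> R} \<in> v} \<in> u"
    using ST ultrafilter_over_subset[OF u] by (intro ultrafilter_over_mono[OF u ST(2)]) auto
  then show "(u, v) \<in> tilde_ext X R" using u v by (simp add: tilde_ext_def beta_def)
qed

lemma tilde_ext_subset_star_ext: "tilde_ext X R \<subseteq> star_ext X R"
proof (rule subrelI)
  fix u v assume "(u, v) \<in> tilde_ext X R"
  then have u: "ultrafilter_over X u" and v: "ultrafilter_over X v"
    and uv: "{x\<in>X. {y\<in>X. (x, y) \<in> R} \<in> v} \<in> u"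
    by (auto simp add: tilde_ext_def beta_def)
  have "{x\<in>X. \<exists>y\<in>S. (x, y) \<in> R} \<in> u" if "S \<in> v" for S
  proof (rule ultrafilter_over_mono[OF u uv])
    show "{x\<in>X. {y\<in>X. (x, y) \<in> R} \<in> v} \<subseteq> {x\<in>X. \<exists>y\<in>S. (x, y) \<in> R}"
      using ultrafilter_over_Int[OF v _ that] ultrafilter_over_nonempty[OF v] by blast
  qed blast
  then show "(u, v) \<in> star_ext X R" using u v by (simp add: star_ext_def beta_def)
qed

lemma costar_ext_subset_tilde_conv_ext: "costar_ext X R \<subseteq> tilde_conv_ext X R"
  using costar_ext_subset_tilde_ext[of X "R\<inverse>"]
  by (auto simp add: tilde_conv_ext_def costar_ext_converse)

lemma tilde_conv_ext_subset_star_ext: "tilde_conv_ext X R \<subseteq> star_ext X R"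
  using tilde_ext_subset_star_ext[of X "R\<inverse>"]
  by (auto simp add: tilde_conv_ext_def star_ext_converse)

lemma tilde_ext_rel_compl:
  "tilde_ext X (rel_compl X R) = rel_compl (beta X) (tilde_ext X R)"
proof -
  have "{x\<in>X. {y\<in>X. (x, y) \<in> rel_compl X R} \<in> v} \<in> u \<longleftrightarrow>
          {x\<in>X. {y\<in>X. (x, y) \<in> R} \<in> v} \<notin> u"
    if u: "ultrafilter_over X u" and v: "ultrafilter_over X v" for u v
  proof -
    have "{y\<in>X. (x, y) \<in> rel_compl X R} \<in> v \<longleftrightarrow> {y\<in>X. (x, y) \<in> R} \<notin> v" if "x \<in> X" for x
    proof -
      have "{y\<in>X. (x, y) \<in> rel_compl X R} = X - {y\<in>X. (x, y) \<in> R}"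
        using that by (auto simp add: rel_compl_def)
      then show ?thesis using ultrafilter_over_Diff_iff[OF v, of "{y\<in>X. (x, y) \<in> R}"] by auto
    qed
    then have "{x\<in>X. {y\<in>X. (x, y) \<in> rel_compl X R} \<in> v} = X - {x\<in>X. {y\<in>X. (x, y) \<in> R} \<in> v}"
      by blast
    then show ?thesis
      using ultrafilter_over_Diff_iff[OF u, of "{x\<in>X. {y\<in>X. (x, y) \<in> R} \<in> v}"] by auto
  qed
  then show ?thesis
    unfolding rel_compl_def[of "beta X"] by (auto simp add: tilde_ext_def beta_def)
qed

lemma rel_compl_rel_compl: "Q \<subseteq> Y \<times> Y \<Longrightarrow> rel_compl Y (rel_compl Y Q) = Q"
  by (auto simp add: rel_compl_def)

text \<open>The least and the greatest of the four extensions agree if one argument is principal.\<close>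

lemma star_ext_imp_costar_ext_if_principal:
  assumes uv: "(u, v) \<in> star_ext X R" and "{a} \<in> u \<or> {a} \<in> v"
  shows "(u, v) \<in> costar_ext X R"
  using assms(2)
proof
  assume a: "{a} \<in> u"
  have v: "ultrafilter_over X v" using uv by (simp add: star_ext_iff beta_def)
  have "{y\<in>X. (a, y) \<in> R} \<in> v"
  proof (subst ultrafilter_over_mem_iff_meets[OF v], blast, rule ballI)
    fix S assume S: "S \<in> v"
    then have "R \<inter> ({a} \<times> S) \<noteq> {}" using uv a by (simp add: star_ext_iff)
    then show "{y\<in>X. (a, y) \<in> R} \<inter> S \<noteq> {}" using ultrafilter_over_subset[OF v S] by blast
  qed
  moreover have "{a} \<times> {y\<in>X. (a, y) \<in> R} \<subseteq> R" by blast
  ultimately have "\<exists>S\<in>v. \<exists>T\<in>u. T \<times> S \<subseteq> R" using a by (intro bexI)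
  then show ?thesis using uv by (simp add: costar_ext_iff star_ext_iff)
next
  assume a: "{a} \<in> v"
  have "\<forall>S\<in>v. {x\<in>X. \<exists>y\<in>S. (x, y) \<in> R} \<in> u" using uv by (simp add: star_ext_def)
  then have "{x\<in>X. \<exists>y\<in>{a}. (x, y) \<in> R} \<in> u" using a by (rule bspec)
  moreover have "{x\<in>X. \<exists>y\<in>{a}. (x, y) \<in> R} \<times> {a} \<subseteq> R" by blast
  ultimately have "\<exists>S\<in>v. \<exists>T\<in>u. T \<times> S \<subseteq> R" using a by (intro bexI)
  then show ?thesis using uv by (simp add: costar_ext_iff star_ext_iff)
qed

section \<open>Patterns of inclusions\<close>

text \<open>Every inclusion among the four sets is a conjunction of emptiness conditions on the regions.\<close>

lemma inclusions_iff_regions: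
  assumes "A \<subseteq> B" "B \<subseteq> D" "A \<subseteq> C" "C \<subseteq> D"
  shows "A \<subseteq> D"
    and "B \<subseteq> A \<longleftrightarrow> B \<inter> C \<subseteq> A \<and> B \<subseteq> C"
    and "C \<subseteq> A \<longleftrightarrow> B \<inter> C \<subseteq> A \<and> C \<subseteq> B"
    and "D \<subseteq> B \<longleftrightarrow> D \<subseteq> B \<union> C \<and> C \<subseteq> B"
    and "D \<subseteq> C \<longleftrightarrow> D \<subseteq> B \<union> C \<and> B \<subseteq> C"
    and "D \<subseteq> A \<longleftrightarrow> D \<subseteq> B \<union> C \<and> B \<inter> C \<subseteq> A \<and> B \<subseteq> C \<and> C \<subseteq> B"
  using assms by blast+

lemma same_inclusionsI:
  assumes 1: "A \<subseteq> B" "B \<subseteq> D" "A \<subseteq> C" "C \<subseteq> D"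
    and 2: "A' \<subseteq> B'" "B' \<subseteq> D'" "A' \<subseteq> C'" "C' \<subseteq> D'"
    and "B \<inter> C \<subseteq> A \<longleftrightarrow> B' \<inter> C' \<subseteq> A'" "B \<subseteq> C \<longleftrightarrow> B' \<subseteq> C'"
      "C \<subseteq> B \<longleftrightarrow> C' \<subseteq> B'" "D \<subseteq> B \<union> C \<longleftrightarrow> D' \<subseteq> B' \<union> C'"
  shows "same_inclusions [A, B, C, D] [A', B', C', D']"
  unfolding same_inclusions_def
  by (simp add: assms inclusions_iff_regions[OF 1] inclusions_iff_regions[OF 2]
      All_less_Suc numeral_eq_Suc)

section \<open>A model for every pattern\<close>

text \<open>
  A disjoint union of relations on the four residue classes modulo 4. On the classes 0, 1, 2, 3 it
  is the restriction of \<open>\<noteq>\<close>, \<open><\<close>, \<open>>\<close>, \<open>=\<close>, respectively, if the corresponding switch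
  \<open>p\<close>, \<open>q\<close>, \<open>s\<close>, \<open>t\<close> is on, and empty otherwise.
\<close>

definition model_rel :: "bool \<Rightarrow> bool \<Rightarrow> bool \<Rightarrow> bool \<Rightarrow> nat rel" where
  "model_rel p q s t = {(x, y). x mod 4 = y mod 4 \<and>
     (p \<and> x mod 4 = 0 \<and> x \<noteq> y \<or> q \<and> x mod 4 = 1 \<and> x < y \<or>
      s \<and> x mod 4 = 2 \<and> x > y \<or> t \<and> x mod 4 = 3 \<and> x = y)}"

text \<open>The natural numbers congruent to \<open>i\<close> modulo 4, for a residue \<open>i < 4\<close>.\<close>

definition residue_class :: "nat \<Rightarrow> nat set" where
  "residue_class i = {x. x mod 4 = i}"

lemma infinite_residue_class: "i < 4 \<Longrightarrow> infinite (residue_class i)"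
proof -
  assume "i < 4"
  then have "range (\<lambda>k. 4 * k + i) \<subseteq> residue_class i" by (auto simp add: residue_class_def)
  moreover have "infinite (range (\<lambda>k::nat. 4 * k + i))"
    by (simp add: finite_image_iff inj_on_def)
  ultimately show ?thesis using finite_subset by blast
qed

lemma ultrafilter_over_ex_residue_class:
  assumes u: "ultrafilter_over UNIV u"
  shows "\<exists>i<4. residue_class i \<in> u"
proof (rule ccontr)
  assume none: "\<not> ?thesis"
  have compl: "UNIV - residue_class i \<in> u" if "i < 4" for i
    using none that ultrafilter_over_Diff_iff[OF u, of "residue_class i"] by auto
  have "(UNIV - residue_class 0) \<inter> (UNIV - residue_class 1) \<inter>
      ((UNIV - residue_class 2) \<inter> (UNIV - residue_class 3)) \<in> u"
    by (intro ultrafilter_over_Int[OF u] compl) simp_all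
  moreover have "x \<in> residue_class 0 \<union> residue_class 1 \<union> residue_class 2 \<union> residue_class 3" for x
  proof -
    have "n = 0 \<or> n = 1 \<or> n = 2 \<or> n = 3" if "n < 4" for n :: nat
      using that by linarith
    from this[of "x mod 4"] show ?thesis by (simp add: residue_class_def)
  qed
  then have "(UNIV - residue_class 0) \<inter> (UNIV - residue_class 1) \<inter>
      ((UNIV - residue_class 2) \<inter> (UNIV - residue_class 3)) = {}"
    by blast
  ultimately show False using ultrafilter_over_nonempty[OF u] by metis
qed

text \<open>
  Whether a set belongs to a nonprincipal ultrafilter can be decided inside one of its members
  \<open>K\<close>, and finitely many elements of \<open>K\<close> do not count.
\<close>

lemma nonprincipal_Collect_mem:
  assumes u: "ultrafilter_over UNIV u" and np: "\<And>x. {x} \<notin> u" and K: "K \<in> u"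
  shows "finite {x \<in> K. \<not> P x} \<Longrightarrow> Collect P \<in> u"
    and "finite {x \<in> K. P x} \<Longrightarrow> Collect P \<notin> u"
proof -
  have *: "Collect Q \<notin> u" if "finite {x \<in> K. Q x}" for Q
  proof
    assume "Collect Q \<in> u"
    then have "K \<inter> Collect Q \<in> u" by (rule ultrafilter_over_Int[OF u K])
    moreover have "K \<inter> Collect Q = {x \<in> K. Q x}" by blast
    ultimately show False using nonprincipal_finite_notin[OF u np that] by simp
  qed
  show "Collect P \<notin> u" if "finite {x \<in> K. P x}" by (rule *[OF that])
  have "UNIV - Collect P = {x. \<not> P x}" by blast
  then show "Collect P \<in> u" if "finite {x \<in> K. \<not> P x}"
    using *[OF that] ultrafilter_over_Diff_iff[OF u, of "Collect P"] by simp
qed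

text \<open>
  If the switch for the residue class of \<open>x\<close> is on, then on this class the section of \<open>model_rel\<close> at \<open>x\<close> is cofinite for \<open>\<noteq>\<close> and \<open><\<close>, and
  finite for \<open>>\<close> and \<open>=\<close>. In all other cases it is empty. For sections in the other coordinate
  \<open><\<close> and \<open>>\<close> change roles.
\<close>

lemma model_rel_right_section:
  assumes v: "ultrafilter_over UNIV v" and np: "\<And>y. {y} \<notin> v" and j: "residue_class j \<in> v"
  shows "{y. (x, y) \<in> model_rel p q s t} \<in> v \<longleftrightarrow> x mod 4 = j \<and> (p \<and> j = 0 \<or> q \<and> j = 1)"
proof (cases "x mod 4 = j \<and> (p \<and> j = 0 \<or> q \<and> j = 1)")
  case True
  then have "{y \<in> residue_class j. \<not> (x, y) \<in> model_rel p q s t} \<subseteq> {..x}"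
    by (auto simp add: model_rel_def residue_class_def)
  then have "finite {y \<in> residue_class j. \<not> (x, y) \<in> model_rel p q s t}"
    by (rule finite_subset) simp
  from nonprincipal_Collect_mem(1)[OF v np j this] True show ?thesis by simp
next
  case False
  then have "{y \<in> residue_class j. (x, y) \<in> model_rel p q s t} \<subseteq> {..x}"
    by (auto simp add: model_rel_def residue_class_def)
  then have "finite {y \<in> residue_class j. (x, y) \<in> model_rel p q s t}"
    by (rule finite_subset) simp
  from nonprincipal_Collect_mem(2)[OF v np j this] False show ?thesis by simp
qed

lemma model_rel_left_section:
  assumes u: "ultrafilter_over UNIV u" and np: "\<And>x. {x} \<notin> u" and i: "residue_class i \<in> u"
  shows "{x. (x, y) \<in> model_rel p q s t} \<in> u \<longleftrightarrow> y mod 4 = i \<and> (p \<and> i = 0 \<or> s \<and> i = 2)"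
proof (cases "y mod 4 = i \<and> (p \<and> i = 0 \<or> s \<and> i = 2)")
  case True
  then have "{x \<in> residue_class i. \<not> (x, y) \<in> model_rel p q s t} \<subseteq> {..y}"
    by (auto simp add: model_rel_def residue_class_def)
  then have "finite {x \<in> residue_class i. \<not> (x, y) \<in> model_rel p q s t}"
    by (rule finite_subset) simp
  from nonprincipal_Collect_mem(1)[OF u np i this] True show ?thesis by simp
next
  case False
  then have "{x \<in> residue_class i. (x, y) \<in> model_rel p q s t} \<subseteq> {..y}"
    by (auto simp add: model_rel_def residue_class_def)
  then have "finite {x \<in> residue_class i. (x, y) \<in> model_rel p q s t}"
    by (rule finite_subset) simp
  from nonprincipal_Collect_mem(2)[OF u np i this] False show ?thesis by simp
qed

lemma residue_class_in_ultrafilter_over_unique: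
  assumes u: "ultrafilter_over UNIV u" and "residue_class i \<in> u" "residue_class j \<in> u"
  shows "i = j"
proof -
  have "residue_class i \<inter> residue_class j \<noteq> {}"
    using ultrafilter_over_Int[OF assms] by (rule ultrafilter_over_nonempty[OF u])
  then show ?thesis by (auto simp add: residue_class_def)
qed

lemma Collect_mod_conj_in_ultrafilter_over_iff:
  assumes u: "ultrafilter_over UNIV u" and i: "residue_class i \<in> u"
  shows "{x. x mod 4 = j \<and> P} \<in> u \<longleftrightarrow> i = j \<and> P"
proof (cases P)
  case True
  then have "{x. x mod 4 = j \<and> P} = residue_class j" by (simp add: residue_class_def)
  then show ?thesis
    using True i residue_class_in_ultrafilter_over_unique[OF u i] by metis
next
  case False
  moreover have "{} \<notin> u" using u by (simp add: ultrafilter_over_def)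
  ultimately show ?thesis by simp
qed

lemma model_rel_tilde_ext_iff:
  assumes u: "ultrafilter_over UNIV u" and i: "residue_class i \<in> u"
    and v: "ultrafilter_over UNIV v" "\<And>y. {y} \<notin> v" "residue_class j \<in> v"
  shows "(u, v) \<in> tilde_ext UNIV (model_rel p q s t) \<longleftrightarrow> i = j \<and> (p \<and> j = 0 \<or> q \<and> j = 1)"
  using u v(1) Collect_mod_conj_in_ultrafilter_over_iff[OF u i]
  by (simp add: tilde_ext_def beta_def model_rel_right_section[OF v])

lemma model_rel_tilde_conv_ext_iff:
  assumes u: "ultrafilter_over UNIV u" "\<And>x. {x} \<notin> u" "residue_class i \<in> u"
    and v: "ultrafilter_over UNIV v" and j: "residue_class j \<in> v"
  shows "(u, v) \<in> tilde_conv_ext UNIV (model_rel p q s t) \<longleftrightarrow>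
    j = i \<and> (p \<and> i = 0 \<or> s \<and> i = 2)"
  using u(1) v Collect_mod_conj_in_ultrafilter_over_iff[OF v j]
  by (simp add: tilde_conv_ext_iff beta_def model_rel_left_section[OF u])

lemma model_rel_star_ext_imp:
  assumes uv: "(u, v) \<in> star_ext UNIV (model_rel p q s t)"
    and "residue_class i \<in> u" "residue_class j \<in> v"
  shows "i = j \<and> (p \<and> i = 0 \<or> q \<and> i = 1 \<or> s \<and> i = 2 \<or> t \<and> i = 3)"
proof -
  have "model_rel p q s t \<inter> (residue_class i \<times> residue_class j) \<noteq> {}"
    using assms unfolding star_ext_iff by blast
  then show ?thesis by (auto simp add: model_rel_def residue_class_def)
qed

text \<open>
  Each switch governs exactly one of the four regions. If it is on, then a nonprincipal ultrafilter that contains the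
  matching residue class, paired with itself, is a point of the region.
\<close>

lemma model_rel_regions:
  fixes p q s t
  defines "R \<equiv> model_rel p q s t"
  shows "tilde_ext UNIV R \<inter> tilde_conv_ext UNIV R \<subseteq> costar_ext UNIV R \<longleftrightarrow> \<not> p" (is ?P)
    and "tilde_ext UNIV R \<subseteq> tilde_conv_ext UNIV R \<longleftrightarrow> \<not> q" (is ?Q)
    and "tilde_conv_ext UNIV R \<subseteq> tilde_ext UNIV R \<longleftrightarrow> \<not> s" (is ?S)
    and "star_ext UNIV R \<subseteq> tilde_ext UNIV R \<union> tilde_conv_ext UNIV R \<longleftrightarrow> \<not> t" (is ?T)
proof -
  let ?A = "costar_ext UNIV R" and ?B = "tilde_ext UNIV R"
    and ?C = "tilde_conv_ext UNIV R" and ?D = "star_ext UNIV R"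
  note incl = subsetD[OF costar_ext_subset_tilde_ext[of UNIV R]]
    subsetD[OF tilde_ext_subset_star_ext[of UNIV R]]
    subsetD[OF costar_ext_subset_tilde_conv_ext[of UNIV R]]
    subsetD[OF tilde_conv_ext_subset_star_ext[of UNIV R]]
  \<comment> \<open>points of \<open>R\<^sup>*\<close> outside \<open>-((-R)\<^sup>*)\<close> are nonprincipal in both coordinates\<close>
  have off: "\<exists>i::nat. ((u, v) \<in> ?B \<longleftrightarrow> p \<and> i = 0 \<or> q \<and> i = 1) \<and>
      ((u, v) \<in> ?C \<longleftrightarrow> p \<and> i = 0 \<or> s \<and> i = 2) \<and>
      (p \<and> i = 0 \<or> q \<and> i = 1 \<or> s \<and> i = 2 \<or> t \<and> i = 3)"
    if D: "(u, v) \<in> ?D" and A: "(u, v) \<notin> ?A" for u v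
  proof -
    have u: "ultrafilter_over UNIV u" and v: "ultrafilter_over UNIV v"
      using D by (auto simp add: star_ext_iff beta_def)
    have np: "\<And>x. {x} \<notin> u" "\<And>x. {x} \<notin> v"
      using star_ext_imp_costar_ext_if_principal[OF D] A by blast+
    obtain i where i: "residue_class i \<in> u"
      using ultrafilter_over_ex_residue_class[OF u] by blast
    obtain j where j: "residue_class j \<in> v"
      using ultrafilter_over_ex_residue_class[OF v] by blast
    show ?thesis
      using model_rel_star_ext_imp[OF D[unfolded R_def] i j]
        model_rel_tilde_ext_iff[OF u i v np(2) j, of p q s t]
        model_rel_tilde_conv_ext_iff[OF u np(1) i v j, of p q s t]
      by (intro exI[of _ i]) (auto simp add: R_def)
  qed
  have diag: "\<exists>u. ultrafilter_over UNIV u \<and> residue_class i \<in> u \<and>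
      ((u, u) \<in> ?B \<longleftrightarrow> p \<and> i = 0 \<or> q \<and> i = 1) \<and>
      ((u, u) \<in> ?C \<longleftrightarrow> p \<and> i = 0 \<or> s \<and> i = 2)"
    if i4: "i < 4" for i :: nat
  proof -
    obtain u where u: "ultrafilter_over UNIV u" "\<And>x. {x} \<notin> u" and i: "residue_class i \<in> u"
      using ex_nonprincipal_ultrafilter_over[OF infinite_residue_class[OF i4]] by auto
    show ?thesis
      using u i model_rel_tilde_ext_iff[OF u(1) i u i, of p q s t]
        model_rel_tilde_conv_ext_iff[OF u i u(1) i, of p q s t]
      by (intro exI[of _ u]) (auto simp add: R_def)
  qed
  show ?P
  proof (cases p)
    case True
    obtain u where u: "ultrafilter_over UNIV u" "residue_class 0 \<in> u" and "(u, u) \<in> ?B \<inter> ?C"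
      using diag[of 0] True by auto
    \<comment> \<open>a box at \<open>(u, u)\<close> contains a diagonal point of the class 0, where \<open>R\<close> is \<open>\<noteq>\<close>\<close>
    moreover have "(u, u) \<notin> ?A"
    proof
      assume "(u, u) \<in> ?A"
      then obtain S T where ST: "S \<in> u" "T \<in> u" "T \<times> S \<subseteq> R"
        by (auto simp add: costar_ext_iff)
      then have "T \<inter> S \<inter> residue_class 0 \<in> u" using ultrafilter_over_Int[OF u(1)] u(2) by blast
      then obtain x where "x \<in> T \<inter> S \<inter> residue_class 0"
        using ultrafilter_over_nonempty[OF u(1)] by blast
      then have "(x, x) \<in> R" "x mod 4 = 0" using ST(3) by (auto simp add: residue_class_def)
      then show False by (simp add: R_def model_rel_def)
    qed
    ultimately show ?thesis using True by blast
  next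
    case False
    have "(u, v) \<in> ?A" if "(u, v) \<in> ?B \<inter> ?C" for u v
      using off[of u v] that False incl by auto
    then have "?B \<inter> ?C \<subseteq> ?A" by (rule subrelI)
    with False show ?thesis by simp
  qed
  show ?Q
  proof (cases q)
    case True
    then show ?thesis using diag[of 1] by auto
  next
    case False
    have "(u, v) \<in> ?C" if "(u, v) \<in> ?B" for u v
      using off[of u v] that False incl by blast
    then have "?B \<subseteq> ?C" by (rule subrelI)
    with False show ?thesis by simp
  qed
  show ?S
  proof (cases s)
    case True
    then show ?thesis using diag[of 2] by auto
  next
    case False
    have "(u, v) \<in> ?B" if "(u, v) \<in> ?C" for u v
      using off[of u v] that False incl by blast
    then have "?C \<subseteq> ?B" by (rule subrelI)
    with False show ?thesis by simp
  qed
  show ?T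
  proof (cases t)
    case True
    obtain u where u: "ultrafilter_over UNIV u" "residue_class 3 \<in> u" and "(u, u) \<notin> ?B \<union> ?C"
      using diag[of 3] by auto
    \<comment> \<open>on the class 3 the diagonal belongs to \<open>R\<close> and meets every box at \<open>(u, u)\<close>\<close>
    moreover have "R \<inter> (T \<times> S) \<noteq> {}" if "S \<in> u" "T \<in> u" for S T
    proof -
      have "T \<inter> S \<inter> residue_class 3 \<in> u" using ultrafilter_over_Int[OF u(1)] u(2) that by blast
      then obtain x where x: "x \<in> T \<inter> S \<inter> residue_class 3"
        using ultrafilter_over_nonempty[OF u(1)] by blast
      then have "(x, x) \<in> R" using True by (simp add: R_def model_rel_def residue_class_def)
      then show ?thesis using x by blast
    qed
    then have "(u, u) \<in> ?D" using u(1) by (simp add: star_ext_iff beta_def)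
    ultimately show ?thesis using True by blast
  next
    case False
    have "(u, v) \<in> ?B \<union> ?C" if "(u, v) \<in> ?D" for u v
      using off[of u v] that False incl by blast
    then have "?D \<subseteq> ?B \<union> ?C" by (rule subrelI)
    with False show ?thesis by simp
  qed
qed

lemma beta_embed_UNIV_psubset_costar_ext:
  assumes "infinite (UNIV :: 'a set)"
  shows "beta_embed (UNIV :: 'a set) UNIV \<subset> costar_ext UNIV UNIV"
proof -
  obtain u :: "'a set set" where u: "ultrafilter_over UNIV u" "\<And>x. {x} \<notin> u"
    using ex_nonprincipal_ultrafilter_over[OF assms] by auto
  have "UNIV \<in> u" using u(1) by (simp add: ultrafilter_over_def)
  then have "(u, u) \<in> costar_ext UNIV UNIV"
    using u(1) by (auto simp add: costar_ext_iff beta_def)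
  moreover have "(u, u) \<notin> beta_embed UNIV UNIV"
    using u(2) by (auto simp add: beta_embed_def principal_uf_def)
  moreover have "beta_embed (UNIV :: 'a set) UNIV \<subseteq> costar_ext UNIV UNIV"
    by (rule beta_embed_subset_costar_ext) simp
  ultimately show ?thesis by blast
qed

section \<open>The realized relationships between the extensions\<close>

theorem theorem1:
  shows
    "(\<forall>(X :: 'a set) R. R \<subseteq> X \<times> X \<longrightarrow>
        beta_embed X R \<subseteq> costar_ext X R \<and>
        costar_ext X R \<subseteq> tilde_ext X R \<and>
        tilde_ext X R = rel_compl (beta X) (tilde_ext X (rel_compl X R)) \<and>
        costar_ext X R \<subseteq> tilde_conv_ext X R \<and>
        tilde_ext X R \<subseteq> star_ext X R \<and>
        tilde_conv_ext X R \<subseteq> star_ext X R \<and>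
        star_ext X R = (star_ext X (R\<inverse>))\<inverse>)
     \<and>
     ((\<exists>(X :: nat set) R. R \<subseteq> X \<times> X \<and> beta_embed X R \<subset> costar_ext X R) \<and>
      (\<exists>(X :: nat set) R. R \<subseteq> X \<times> X \<and> costar_ext X R \<subset> tilde_ext X R) \<and>
      (\<exists>(X :: nat set) R. R \<subseteq> X \<times> X \<and> costar_ext X R \<subset> tilde_conv_ext X R) \<and>
      (\<exists>(X :: nat set) R. R \<subseteq> X \<times> X \<and> tilde_ext X R \<subset> star_ext X R) \<and>
      (\<exists>(X :: nat set) R. R \<subseteq> X \<times> X \<and> tilde_conv_ext X R \<subset> star_ext X R))
     \<and>
     (\<forall>(A :: 'b set) B C D. A \<subseteq> B \<and> B \<subseteq> D \<and> A \<subseteq> C \<and> C \<subseteq> D \<longrightarrow>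
        (\<exists>(X :: nat set) R. R \<subseteq> X \<times> X \<and>
           same_inclusions [A, B, C, D]
             [costar_ext X R, tilde_ext X R, tilde_conv_ext X R, star_ext X R]))"
proof (intro conjI allI impI)
  fix X :: "'a set" and R
  assume R: "R \<subseteq> X \<times> X"
  show "beta_embed X R \<subseteq> costar_ext X R" by (rule beta_embed_subset_costar_ext[OF R])
  show "costar_ext X R \<subseteq> tilde_ext X R" by (rule costar_ext_subset_tilde_ext)
  have "tilde_ext X R \<subseteq> beta X \<times> beta X" by (auto simp add: tilde_ext_def)
  then show "tilde_ext X R = rel_compl (beta X) (tilde_ext X (rel_compl X R))"
    by (simp add: tilde_ext_rel_compl rel_compl_rel_compl)
  show "costar_ext X R \<subseteq> tilde_conv_ext X R" by (rule costar_ext_subset_tilde_conv_ext)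
  show "tilde_ext X R \<subseteq> star_ext X R" by (rule tilde_ext_subset_star_ext)
  show "tilde_conv_ext X R \<subseteq> star_ext X R" by (rule tilde_conv_ext_subset_star_ext)
  show "star_ext X R = (star_ext X (R\<inverse>))\<inverse>" by (simp add: star_ext_converse)
next
  show "\<exists>(X :: nat set) R. R \<subseteq> X \<times> X \<and> beta_embed X R \<subset> costar_ext X R"
    using beta_embed_UNIV_psubset_costar_ext[OF infinite_UNIV_nat]
    by (metis UNIV_Times_UNIV subset_UNIV)
next
  let ?R = "model_rel False True True False"
  have sub: "?R \<subseteq> UNIV \<times> UNIV" by simp
  note incl = costar_ext_subset_tilde_ext[of UNIV ?R] tilde_ext_subset_star_ext[of UNIV ?R]
    costar_ext_subset_tilde_conv_ext[of UNIV ?R] tilde_conv_ext_subset_star_ext[of UNIV ?R]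
  \<comment> \<open>with \<open><\<close> and \<open>>\<close> both present, the two tilde extensions are incomparable\<close>
  have incomp: "\<not> tilde_ext UNIV ?R \<subseteq> tilde_conv_ext UNIV ?R"
    "\<not> tilde_conv_ext UNIV ?R \<subseteq> tilde_ext UNIV ?R"
    by (simp_all add: model_rel_regions)
  have "costar_ext UNIV ?R \<subset> tilde_ext UNIV ?R" using incl incomp by blast
  with sub show "\<exists>(X :: nat set) R. R \<subseteq> X \<times> X \<and> costar_ext X R \<subset> tilde_ext X R" by blast
  have "costar_ext UNIV ?R \<subset> tilde_conv_ext UNIV ?R" using incl incomp by blast
  with sub show "\<exists>(X :: nat set) R. R \<subseteq> X \<times> X \<and> costar_ext X R \<subset> tilde_conv_ext X R" by blast
  have "tilde_ext UNIV ?R \<subset> star_ext UNIV ?R" using incl incomp by blast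
  with sub show "\<exists>(X :: nat set) R. R \<subseteq> X \<times> X \<and> tilde_ext X R \<subset> star_ext X R" by blast
  have "tilde_conv_ext UNIV ?R \<subset> star_ext UNIV ?R" using incl incomp by blast
  with sub show "\<exists>(X :: nat set) R. R \<subseteq> X \<times> X \<and> tilde_conv_ext X R \<subset> star_ext X R" by blast
next
  fix A B C D :: "'b set"
  assume ABCD: "A \<subseteq> B \<and> B \<subseteq> D \<and> A \<subseteq> C \<and> C \<subseteq> D"
  let ?R = "model_rel (\<not> B \<inter> C \<subseteq> A) (\<not> B \<subseteq> C) (\<not> C \<subseteq> B) (\<not> D \<subseteq> B \<union> C)"
  have "same_inclusions [A, B, C, D]
      [costar_ext UNIV ?R, tilde_ext UNIV ?R, tilde_conv_ext UNIV ?R, star_ext UNIV ?R]"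
    using ABCD
    by (intro same_inclusionsI costar_ext_subset_tilde_ext tilde_ext_subset_star_ext
        costar_ext_subset_tilde_conv_ext tilde_conv_ext_subset_star_ext)
      (simp_all add: model_rel_regions)
  then show "\<exists>(X :: nat set) R. R \<subseteq> X \<times> X \<and>
      same_inclusions [A, B, C, D]
        [costar_ext X R, tilde_ext X R, tilde_conv_ext X R, star_ext X R]"
    by (intro exI[of _ UNIV] exI[of _ ?R]) simp
qed

end
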